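(* Let $\Gamma$ be a group, let $G=(V,E)$ be a finite graph with a group action $\theta:\Gamma\to \mathrm{Aut}(G)$, and let $X\subseteq V$ be such that $\theta(\gamma)(X)=X$ for all $\gamma\in\Gamma$. Let $\tau:\Gamma\to O(\mathbb{R}^d)$ be a homomorphism and let $\tilde\tau:\Gamma\to O(\mathbb{R}^{d+1})$ be its augmented representation. Then the following are equivalent: (a) $G$ can be realised as an infinitesimally rigid $\Gamma$-symmetric spherical (bar-joint) framework $(G,q)$ on $\mathbb{S}^d$ (with respect to $\theta$ and $\tilde\tau$) such that the points $q(i)$, $i\in X$, lie on the equator. (b) $G$ can be realised as an infinitesimally rigid $\Gamma$-symmetric point-hyperplane framework in $\mathbb{R}^d$ (with respect to $\theta$ and $\tau$) such that each vertex in $X$ is realised as a hyperplane and each vertex in $V\setminus X$ is realised as a point (i.e. $V_H=X$, $V_P=V\setminus X$).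
   Context: Write $\gamma i=\theta(\gamma)(i)$. The augmented representation is $\tilde\tau(\gamma)=\begin{pmatrix}\tau(\gamma)&0\\0&1\end{pmatrix}$. The equator of $\mathbb{S}^d\subset\mathbb{R}^{d+1}$ is its intersection with the hyperplane $x_{d+1}=0$. Spherical frameworks: a spherical framework $(G,q)$ on $\mathbb{S}^d$ is a map $q:V\to\mathbb{S}^d$ whose image linearly spans $\mathbb{R}^{d+1}$. An infinitesimal motion is $\dot q:V\to\mathbb{R}^{d+1}$ with $\langle q_i,\dot q_j\rangle+\langle q_j,\dot q_i\rangle=0$ for $\{i,j\}\in E$ and $\langle q_i,\dot q_i\rangle=0$ for $i\in V$; $(G,q)$ is infinitesimally rigid if the space of infinitesimal motions has dimension $\binom{d+1}{2}$ (i.e. all motions are trivial, of the form $\dot q_i=Sq_i$ with $S$ skew-symmetric). $(G,q)$ is $\Gamma$-symmetric with respect to $\theta,\tilde\tau$ if $\tilde\tau(\gamma)q(i)=q(\gamma i)$ for all $\gamma\in\Gamma$, $i\in V$. Point-hyperplane frameworks: $V$ is partitioned as $V_P\cup V_H$, inducing edge classes $E_{PP},E_{PH},E_{HH}$. A point-hyperplane framework $(G,p,\ell)$ in $\mathbb{R}^d$ has $p:V_P\to\mathbb{R}^d$ and $\ell=(a,r):V_H\to\mathbb{S}^{d-1}\times\mathbb{R}$, vertex $j\in V_H$ representing the hyperplane $\{x:\langle a_j,x\rangle+r_j=0\}$; the points and hyperplanes affinely span $\mathbb{R}^d$. An infinitesimal motion is $(\dot p,\dot a,\dot r)$ with $\dot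 p:V_P\to\mathbb{R}^d$, $\dot a:V_H\to\mathbb{R}^d$, $\dot r:V_H\to\mathbb{R}$ satisfying $\langle p_i-p_j,\dot p_i-\dot p_j\rangle=0$ for $\{i,j\}\in E_{PP}$; $\langle p_i,\dot a_j\rangle+\langle\dot p_i,a_j\rangle+\dot r_j=0$ for $\{i,j\}\in E_{PH}$ with $i\in V_P,j\in V_H$; $\langle a_i,\dot a_j\rangle+\langle\dot a_i,a_j\rangle=0$ for $\{i,j\}\in E_{HH}$; $\langle a_i,\dot a_i\rangle=0$ for $i\in V_H$. It is infinitesimally rigid if this space of motions has dimension $\binom{d+1}{2}$ (every motion is trivial, i.e. induced by isometries of $\mathbb{R}^d$). It is $\Gamma$-symmetric with respect to $\theta$ (which must map $V_P$ to $V_P$ and $V_H$ to $V_H$) and $\tau$ if $\tau(\gamma)p(i)=p(\gamma i)$ for $i\in V_P$, $\tau(\gamma)a(j)=\pm a(\gamma j)$ and $r(j)=r(\gamma j)$ for $j\in V_H$, for all $\gamma\in\Gamma$.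
   Formalization: The sign in τ(γ)a(j)=±a(γj) is taken as s_j·s_{γj} for one choice of signs s, so no γ fixing j∈X reverses its normal (with free signs (b)⇒(a) fails), and "affinely span" means that the vectors (p_i,1) and (a_j,0) span R^{d+1}. *)

theory Defs
  imports "HOL-Analysis.Analysis" "HOL-Algebra.Group"
begin

section \<open>Graphs, groups and representations\<close>

text \<open>
  The vertex set of a finite graph is a finite type, so that assignments of vectors to vertices
  form a Euclidean space \<open>_ ^ 'v\<close> and dimensions of spaces of motions are given by \<open>dim\<close>.
\<close>

definition simple_graph :: "'v::finite set set \<Rightarrow> bool" where
  "simple_graph E \<longleftrightarrow> (\<forall>e\<in>E. card e = 2)"

definition graph_aut :: "'v::finite set set \<Rightarrow> ('v \<Rightarrow> 'v) monoid" where
  "graph_aut E =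
    \<lparr>carrier = {f. bij f \<and> (\<forall>i j. {f i, f j} \<in> E \<longleftrightarrow> {i, j} \<in> E)},
     monoid.mult = (\<circ>), one = id\<rparr>"

definition orthogonal_group :: "('a::real_inner \<Rightarrow> 'a) monoid" where
  "orthogonal_group =
    \<lparr>carrier = {f. orthogonal_transformation f}, monoid.mult = (\<circ>), one = id\<rparr>"

text \<open>
  \<open>\<real>\<^sup>d\<^sup>+\<^sup>1\<close> is \<open>(real ^ 'd) \<times> real\<close>, the second component being the last coordinate; the
  block-diagonal matrix with blocks \<open>\<tau> \<gamma>\<close> and \<open>1\<close> acts componentwise.
\<close>

definition augmented ::
  "('g \<Rightarrow> real ^ 'd \<Rightarrow> real ^ 'd) \<Rightarrow> 'g \<Rightarrow> (real ^ 'd) \<times> real \<Rightarrow> (real ^ 'd) \<times> real" where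
  "augmented \<tau> \<gamma> = (\<lambda>(x, t). (\<tau> \<gamma> x, t))"

section \<open>Spherical frameworks\<close>

definition equator :: "((real ^ 'd) \<times> real) set" where
  "equator = {x \<in> sphere 0 1. snd x = 0}"

definition spherical_framework :: "('v::finite \<Rightarrow> (real ^ 'd) \<times> real) \<Rightarrow> bool" where
  "spherical_framework q \<longleftrightarrow> range q \<subseteq> sphere 0 1 \<and> span (range q) = UNIV"

definition spherical_motions ::
  "'v::finite set set \<Rightarrow> ('v \<Rightarrow> (real ^ 'd) \<times> real) \<Rightarrow> (((real ^ 'd) \<times> real) ^ 'v) set" where
  "spherical_motions E q =
    {q'. (\<forall>i j. {i, j} \<in> E \<longrightarrow> q i \<bullet> (q' $ j) + q j \<bullet> (q' $ i) = 0) \<and>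
         (\<forall>i. q i \<bullet> (q' $ i) = 0)}"

definition spherical_inf_rigid ::
  "'v::finite set set \<Rightarrow> ('v \<Rightarrow> (real ^ 'd) \<times> real) \<Rightarrow> bool" where
  "spherical_inf_rigid E q \<longleftrightarrow> dim (spherical_motions E q) = (CARD('d) + 1) choose 2"

definition spherical_symmetric ::
  "('g, 'm) monoid_scheme \<Rightarrow> ('g \<Rightarrow> 'v \<Rightarrow> 'v) \<Rightarrow>
   ('g \<Rightarrow> (real ^ 'd) \<times> real \<Rightarrow> (real ^ 'd) \<times> real) \<Rightarrow>
   ('v::finite \<Rightarrow> (real ^ 'd) \<times> real) \<Rightarrow> bool" where
  "spherical_symmetric \<Gamma> \<theta> \<rho> q \<longleftrightarrow> (\<forall>\<gamma>\<in>carrier \<Gamma>. \<forall>i. \<rho> \<gamma> (q i) = q (\<theta> \<gamma> i))"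

section \<open>Point-hyperplane frameworks\<close>

text \<open>
  The partition of the vertex set is given by the set \<open>H\<close> of hyperplane vertices; the point
  vertices are \<open>- H\<close>. Vertex \<open>j \<in> H\<close> represents the hyperplane with equation
  \<open>a j \<bullet> x + r j = 0\<close>. The values of \<open>p\<close> on \<open>H\<close> and of \<open>a\<close>, \<open>r\<close> on \<open>- H\<close> are irrelevant.

  In the affine span, a hyperplane contributes the point at infinity in the direction of its
  normal. So the affine span consists of the affine combinations of the points, translated by the
  linear combinations of the normals; equivalently, the vectors \<open>(p i, 1)\<close> and \<open>(a j, 0)\<close> span
  \<open>\<real>\<^sup>d\<^sup>+\<^sup>1\<close>.
\<close>

definition ph_framework ::
  "'v::finite set \<Rightarrow> ('v \<Rightarrow> real ^ 'd) \<Rightarrow> ('v \<Rightarrow> real ^ 'd) \<Rightarrow> ('v \<Rightarrow> real) \<Rightarrow> bool" where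
  "ph_framework H p a r \<longleftrightarrow>
    (\<forall>j\<in>H. a j \<in> sphere 0 1) \<and>
    {x + y | x y. x \<in> affine hull (p ` (- H)) \<and> y \<in> span (a ` H)} = UNIV"

text \<open>
  Motions are only given on \<open>- H\<close> (for \<open>p'\<close>) and on \<open>H\<close> (for \<open>a'\<close>, \<open>r'\<close>); they are extended by
  \<open>0\<close>, which does not affect the dimension.
\<close>

definition ph_motions ::
  "'v::finite set set \<Rightarrow> 'v set \<Rightarrow> ('v \<Rightarrow> real ^ 'd) \<Rightarrow> ('v \<Rightarrow> real ^ 'd) \<Rightarrow> ('v \<Rightarrow> real) \<Rightarrow>
   (((real ^ 'd) ^ 'v) \<times> ((real ^ 'd) ^ 'v) \<times> (real ^ 'v)) set" where
  "ph_motions E H p a r =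
    {(p', a', r').
      (\<forall>i\<in>- H. \<forall>j\<in>- H. {i, j} \<in> E \<longrightarrow> (p i - p j) \<bullet> (p' $ i - p' $ j) = 0) \<and>
      (\<forall>i\<in>- H. \<forall>j\<in>H. {i, j} \<in> E \<longrightarrow> p i \<bullet> (a' $ j) + (p' $ i) \<bullet> a j + r' $ j = 0) \<and>
      (\<forall>i\<in>H. \<forall>j\<in>H. {i, j} \<in> E \<longrightarrow> a i \<bullet> (a' $ j) + (a' $ i) \<bullet> a j = 0) \<and>
      (\<forall>i\<in>H. a i \<bullet> (a' $ i) = 0) \<and>
      (\<forall>i\<in>H. p' $ i = 0) \<and> (\<forall>i\<in>- H. a' $ i = 0 \<and> r' $ i = 0)}"

definition ph_inf_rigid ::
  "'v::finite set set \<Rightarrow> 'v set \<Rightarrow> ('v \<Rightarrow> real ^ 'd) \<Rightarrow> ('v \<Rightarrow> real ^ 'd) \<Rightarrow> ('v \<Rightarrow> real) \<Rightarrow> bool"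
  where
  "ph_inf_rigid E H p a r \<longleftrightarrow> dim (ph_motions E H p a r) = (CARD('d) + 1) choose 2"

text \<open>
  A hyperplane determines its unit normal only up to sign. The condition
  \<open>\<tau>(\<gamma>) a(j) = \<plusminus> a(\<gamma> j)\<close> is read accordingly: it is \<open>\<tau>(\<gamma>) a(j) = a(\<gamma> j)\<close> up to a
  choice \<open>s j\<close> of sign for each normal \<open>a j\<close>, so the sign that occurs is \<open>s j * s (\<gamma> j)\<close>. If the
  sign could be chosen independently for each pair \<open>(\<gamma>, j)\<close>, the normal of an invariant
  hyperplane could be reversed, which is impossible for a point of a symmetric spherical framework.
\<close>

definition ph_symmetric ::
  "('g, 'm) monoid_scheme \<Rightarrow> ('g \<Rightarrow> 'v \<Rightarrow> 'v) \<Rightarrow> ('g \<Rightarrow> real ^ 'd \<Rightarrow> real ^ 'd) \<Rightarrow>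
   'v::finite set \<Rightarrow> ('v \<Rightarrow> real ^ 'd) \<Rightarrow> ('v \<Rightarrow> real ^ 'd) \<Rightarrow> ('v \<Rightarrow> real) \<Rightarrow> bool" where
  "ph_symmetric \<Gamma> \<theta> \<tau> H p a r \<longleftrightarrow>
    (\<forall>\<gamma>\<in>carrier \<Gamma>. \<theta> \<gamma> ` (- H) = - H \<and> \<theta> \<gamma> ` H = H) \<and>
    (\<forall>\<gamma>\<in>carrier \<Gamma>. \<forall>i\<in>- H. \<tau> \<gamma> (p i) = p (\<theta> \<gamma> i)) \<and>
    (\<exists>s :: 'v \<Rightarrow> real. (\<forall>j\<in>H. s j \<in> {1, -1}) \<and>
      (\<forall>\<gamma>\<in>carrier \<Gamma>. \<forall>j\<in>H. \<tau> \<gamma> (a j) = (s j * s (\<theta> \<gamma> j)) *\<^sub>R a (\<theta> \<gamma> j))) \<and>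
    (\<forall>\<gamma>\<in>carrier \<Gamma>. \<forall>j\<in>H. r j = r (\<theta> \<gamma> j))"

end

theory Submission
  imports Defs
begin

text \<open>
  Central projection identifies a point \<open>p\<close> with the direction \<open>(p, 1)\<close> and a hyperplane with
  normal \<open>a\<close> with the equatorial direction \<open>(a, 0)\<close>. The motion conditions are invariant under
  rescaling each vertex, and for the vectors \<open>(p, 1)\<close>, \<open>(a, 0)\<close> they become the
  point-hyperplane conditions once the last coordinate of the velocity of \<open>(p, 1)\<close> is eliminated.
  It remains to treat a spherical framework in which vertices outside \<open>X\<close> lie on the equator. They
  are moved off it by adding \<open>t *\<^sub>R (0, 1)\<close>: the augmented representation fixes \<open>(0, 1)\<close>, so
  the symmetry is kept, and rigidity survives for small \<open>t\<close> because the dimension of the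
  space of motions is upper semicontinuous in \<open>t\<close>, while the skew-symmetric maps bound it
  from below.
\<close>

section \<open>Semicontinuity of kernels\<close>

text \<open>Compactness: the pairs of a parameter in \<open>cball 0 1\<close> and a unit vector of
  \<open>W\<close> lying in the corresponding \<open>K t\<close> form a compact set. Its projection
  to the parameters is closed and misses 0, hence misses a neighbourhood of 0.\<close>

lemma eventually_Int_trivial:
  fixes K :: "real \<Rightarrow> 'a::euclidean_space set"
  assumes K: "closed {(t, w). w \<in> K t}" "\<And>t. subspace (K t)"
    and W: "subspace W" and triv: "K 0 \<inter> W \<subseteq> {0}"
  shows "\<forall>\<^sub>F t in at 0. K t \<inter> W \<subseteq> {0}"
proof -
  let ?C = "(cball 0 1 \<times> (sphere 0 1 \<inter> W)) \<inter> {(t, w). w \<in> K t}"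
  have "compact ?C"
    using W K(1) by (auto intro!: compact_Int_closed[OF compact_Times] closed_subspace)
  then have "closed (fst ` ?C)"
    by (intro compact_imp_closed compact_continuous_image continuous_intros)
  moreover have "0 \<notin> fst ` ?C"
    using triv by force
  ultimately have "\<forall>\<^sub>F t in nhds 0. t \<in> - (fst ` ?C)"
    by (intro eventually_nhds_in_open) auto
  moreover have "\<forall>\<^sub>F t in nhds 0. t \<in> ball 0 (1::real)"
    by (intro eventually_nhds_in_open) auto
  ultimately have "\<forall>\<^sub>F t in nhds 0. K t \<inter> W \<subseteq> {0}"
  proof eventually_elim
    case (elim t)
    show ?case
    proof (rule ccontr)
      assume "\<not> ?thesis"
      then obtain w where w: "w \<in> K t" "w \<in> W" "w \<noteq> 0"
        by blast
      \<comment> \<open>As \<open>K t\<close> and \<open>W\<close> are subspaces, a nonzero common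
        vector can be normalised into the compact set.\<close>
      then have "w /\<^sub>R norm w \<in> K t" "w /\<^sub>R norm w \<in> W" "norm (w /\<^sub>R norm w) = 1"
        using K(2)[of t] W by (auto intro: subspace_scale)
      then have "(t, w /\<^sub>R norm w) \<in> ?C"
        using elim by auto
      then show False
        using elim by (metis ComplD fst_conv imageI)
    qed
  qed
  then show ?thesis
    by (auto simp: eventually_at_filter elim: eventually_mono)
qed

text \<open>The orthogonal complement of \<open>K 0\<close> still meets \<open>K t\<close> trivially
  for small \<open>t\<close>, which leaves no room for \<open>K t\<close> to have a larger dimension
  than \<open>K 0\<close>.\<close>

lemma eventually_dim_le:
  fixes K :: "real \<Rightarrow> 'a::euclidean_space set"
  assumes K: "closed {(t, w). w \<in> K t}" "\<And>t. subspace (K t)"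
  shows "\<forall>\<^sub>F t in at 0. dim (K t) \<le> dim (K 0)"
proof -
  let ?W = "{y \<in> UNIV. \<forall>x\<in>K 0. orthogonal x y}"
  have W: "subspace ?W"
    by (simp add: subspace_orthogonal_to_vectors)
  have dimW: "dim ?W + dim (K 0) = DIM('a)"
    using dim_subspace_orthogonal_to_vectors[OF K(2)[of 0] subspace_UNIV] by simp
  have "K 0 \<inter> ?W \<subseteq> {0}"
    by (auto simp: orthogonal_def)
  from eventually_Int_trivial[OF K W this] show ?thesis
  proof eventually_elim
    case (elim t)
    then have "dim (K t \<inter> ?W) = 0"
      by (simp add: dim_eq_0)
    then have "dim (K t) + dim ?W \<le> DIM('a)"
      using dim_sums_Int[OF K(2)[of t] W] dim_subset_UNIV[of "{x + y |x y. x \<in> K t \<and> y \<in> ?W}"]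
      by linarith
    with dimW show ?case
      by linarith
  qed
qed

text \<open>Turns spanning into the triviality of a kernel, so that
  \<open>eventually_Int_trivial\<close> with \<open>W = UNIV\<close> shows that spanning is an open
  condition.\<close>

lemma span_eq_UNIV_iff_orthogonal:
  fixes S :: "'a::euclidean_space set"
  shows "span S = UNIV \<longleftrightarrow> {x. \<forall>s\<in>S. s \<bullet> x = 0} \<subseteq> {0}"
proof
  assume S: "span S = UNIV"
  show "{x. \<forall>s\<in>S. s \<bullet> x = 0} \<subseteq> {0}"
  proof
    fix x assume "x \<in> {x. \<forall>s\<in>S. s \<bullet> x = 0}"
    then have "orthogonal x y" if "y \<in> S" for y
      using that by (simp add: orthogonal_def inner_commute[of x])
    then have "orthogonal x x"
      using orthogonal_to_span[of x S x] by (simp add: S)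
    then show "x \<in> {0}"
      by (simp add: orthogonal_def)
  qed
next
  assume S: "{x. \<forall>s\<in>S. s \<bullet> x = 0} \<subseteq> {0}"
  show "span S = UNIV"
  proof (rule ccontr)
    assume "span S \<noteq> UNIV"
    then obtain a where a: "a \<noteq> 0" "\<forall>x\<in>span S. a \<bullet> x = 0"
      using span_not_UNIV_orthogonal by blast
    then have "a \<in> {x. \<forall>s\<in>S. s \<bullet> x = 0}"
      by (simp add: inner_commute[of _ a] span_base)
    with S a(1) show False
      by blast
  qed
qed

lemma span_scaled_range:
  fixes u :: "'v \<Rightarrow> 'a::real_vector"
  assumes "\<And>i. c i \<noteq> 0"
  shows "span (range (\<lambda>i. c i *\<^sub>R u i)) = span (range u)"
proof (rule span_eq[THEN iffD2], intro conjI subsetI)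
  fix x assume "x \<in> range u"
  then obtain i where "x = u i" by auto
  then have x: "x = inverse (c i) *\<^sub>R (c i *\<^sub>R u i)"
    using assms by simp
  show "x \<in> span (range (\<lambda>i. c i *\<^sub>R u i))"
    unfolding x by (rule span_scale[OF span_base]) (rule rangeI)
next
  fix x assume "x \<in> range (\<lambda>i. c i *\<^sub>R u i)"
  then obtain i where x: "x = c i *\<^sub>R u i" by auto
  show "x \<in> span (range u)"
    unfolding x by (rule span_scale[OF span_base]) (rule rangeI)
qed

section \<open>Spaces of motions\<close>

lemma subspace_spherical_motions: "subspace (spherical_motions E q)"
proof (rule subspaceI)
  fix x y assume x: "x \<in> spherical_motions E q" and y: "y \<in> spherical_motions E q"
  have sum: "q i \<bullet> ((x + y) $ j) + q j \<bullet> ((x + y) $ i) =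
      (q i \<bullet> (x $ j) + q j \<bullet> (x $ i)) + (q i \<bullet> (y $ j) + q j \<bullet> (y $ i))" for i j
    by (simp add: inner_add_right)
  show "x + y \<in> spherical_motions E q"
    using x y unfolding spherical_motions_def mem_Collect_eq sum by (simp add: inner_add_right)
qed (auto simp: spherical_motions_def distrib_left[symmetric])

text \<open>The motion conditions are equations between functions jointly continuous in
  \<open>t\<close> and \<open>w\<close>; this supplies the closedness needed for
  \<open>eventually_dim_le\<close>.\<close>

lemma closed_spherical_motions:
  fixes u :: "real \<Rightarrow> 'v::finite \<Rightarrow> (real ^ 'd) \<times> real"
  assumes "\<And>i. continuous_on UNIV (\<lambda>t. u t i)"
  shows "closed {(t, w). w \<in> spherical_motions E (u t)}"
proof -
  have u: "continuous_on UNIV (\<lambda>x. u (fst x) i)" for i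
    by (rule continuous_on_compose2[OF assms]) (auto intro: continuous_intros)
  show ?thesis
    unfolding spherical_motions_def case_prod_unfold mem_Collect_eq
    by (intro closed_Collect_conj closed_Collect_all closed_Collect_imp closed_Collect_eq
        continuous_intros u) auto
qed

text \<open>Scaling the velocity at \<open>i\<close> by the same \<open>c i\<close> multiplies the
  condition for \<open>{i, j}\<close> by \<open>c i * c j\<close> and the one at \<open>i\<close> by
  the square of \<open>c i\<close>, so it is a linear isomorphism of the motion spaces.\<close>

lemma dim_spherical_motions_scaled:
  fixes u :: "'v::finite \<Rightarrow> (real ^ 'd) \<times> real"
  assumes "\<And>i. c i \<noteq> (0::real)"
  shows "dim (spherical_motions E (\<lambda>i. c i *\<^sub>R u i)) = dim (spherical_motions E u)"
proof -
  define f where "f w = (\<chi> i. c i *\<^sub>R (w $ i))" for w :: "((real ^ 'd) \<times> real) ^ 'v"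
  have f: "linear f"
    by (auto simp: f_def linear_iff vec_eq_iff algebra_simps)
  have "inj f"
    using assms by (auto simp: f_def inj_def vec_eq_iff)
  have mem: "f w \<in> spherical_motions E (\<lambda>i. c i *\<^sub>R u i) \<longleftrightarrow> w \<in> spherical_motions E u" for w
  proof -
    have "(c i *\<^sub>R u i) \<bullet> (f w $ j) + (c j *\<^sub>R u j) \<bullet> (f w $ i) =
        (c i * c j) * (u i \<bullet> (w $ j) + u j \<bullet> (w $ i))" for i j
      by (simp add: f_def algebra_simps)
    then show ?thesis
      using assms by (simp add: spherical_motions_def) (simp add: f_def assms)
  qed
  have "w = f (\<chi> i. (w $ i) /\<^sub>R c i)" for w
    using assms by (simp add: f_def vec_eq_iff)
  then have "f ` spherical_motions E u = spherical_motions E (\<lambda>i. c i *\<^sub>R u i)"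
    using mem by (auto simp: image_iff) metis
  moreover have "dim (f ` spherical_motions E u) = dim (spherical_motions E u)"
    using f \<open>inj f\<close> by (intro dim_image_eq) (auto intro: inj_on_subset)
  ultimately show ?thesis
    by simp
qed

text \<open>Independence is stated for the indexed family; it also forces \<open>M\<close> to be
  injective, so no member is counted twice.\<close>

lemma card_le_dim_family:
  fixes M :: "'i \<Rightarrow> 'a::euclidean_space"
  assumes I: "finite I" and M: "M ` I \<subseteq> S"
    and indep: "\<And>c. (\<Sum>i\<in>I. c i *\<^sub>R M i) = 0 \<Longrightarrow> \<forall>i\<in>I. c i = 0"
  shows "card I \<le> dim S"
proof -
  have inj: "inj_on M I"
  proof (rule inj_onI, rule ccontr)
    fix i j assume ij: "i \<in> I" "j \<in> I" "M i = M j" "i \<noteq> j"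
    \<comment> \<open>If \<open>M i = M j\<close>, the difference of the indicators of
      \<open>i\<close> and \<open>j\<close> is a nontrivial relation.\<close>
    define c where "c k = (if k = i then 1 else 0) - (if k = j then 1 else (0::real))" for k
    have "(\<Sum>k\<in>I. c k *\<^sub>R M k) = 0"
      using I ij by (simp add: c_def scaleR_diff_left sum_subtractf if_distrib[of "\<lambda>x. x *\<^sub>R _"]
          cong: if_cong)
    with indep have "c i = 0"
      using ij by blast
    with ij show False
      by (simp add: c_def)
  qed
  have "independent (M ` I)"
  proof (rule independent_if_scalars_zero)
    fix g x assume "(\<Sum>x\<in>M ` I. g x *\<^sub>R x) = 0" "x \<in> M ` I"
    then show "g x = 0"
      using indep[of "g \<circ> M"] inj by (auto simp: sum.reindex)
  qed (use I in simp)
  then have "card (M ` I) \<le> dim S"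
    using M by (intro independent_card_le_dim)
  then show ?thesis
    by (simp add: card_image inj)
qed

text \<open>Elementary skew-symmetric maps, one for each pair of basis vectors, restrict to motions.
  A combination vanishing at the points vanishes everywhere because the points span, so these
  motions are independent.\<close>

lemma dim_spherical_motions_ge:
  fixes q :: "'v::finite \<Rightarrow> (real ^ 'd) \<times> real"
  assumes q: "span (range q) = UNIV"
  shows "(CARD('d) + 1) choose 2 \<le> dim (spherical_motions E q)"
proof -
  define n where "n = CARD('d) + 1"
  have "card (Basis :: ((real ^ 'd) \<times> real) set) = n"
    by (simp add: n_def)
  then obtain f :: "nat \<Rightarrow> (real ^ 'd) \<times> real" where f: "bij_betw f {..<n} Basis"
    using ex_bij_betw_nat_finite[OF finite_Basis] by (metis atLeast0LessThan)
  have ff: "f k \<bullet> f l = (if k = l then 1 else 0)" if "k < n" "l < n" for k l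
  proof -
    have "f k \<in> Basis" "f l \<in> Basis" "f k = f l \<longleftrightarrow> k = l"
      using f that by (auto simp: bij_betw_def inj_on_def)
    then show ?thesis
      by (simp add: inner_Basis)
  qed
  define I where "I = (SIGMA l:{..<n}. {..<l})"
  \<comment> \<open>\<open>S (l, k)\<close> is the infinitesimal rotation taking \<open>f k\<close>
    to \<open>f l\<close> and \<open>f l\<close> to \<open>- f k\<close>; \<open>I\<close> lists the
    pairs with \<open>k < l\<close>.\<close>
  define S where "S = (\<lambda>(l, k) x. (f k \<bullet> x) *\<^sub>R f l - (f l \<bullet> x) *\<^sub>R f k)"
  define M where "M m = (\<chi> i. S m (q i))" for m
  have linS: "linear (S m)" for m
    by (auto simp: S_def split_def linear_iff algebra_simps)
  have skew: "x \<bullet> S m y + y \<bullet> S m x = 0" for m x y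
    by (simp add: S_def split_def algebra_simps inner_commute)
  have "x \<bullet> S m x = 0" for m x
    using skew[of x m x] by simp
  then have "M m \<in> spherical_motions E q" for m
    by (simp add: spherical_motions_def M_def skew)
  moreover have "\<forall>m\<in>I. c m = 0" if c: "(\<Sum>m\<in>I. c m *\<^sub>R M m) = 0" for c
  proof
    fix m0 assume m0: "m0 \<in> I"
    obtain l k where lk: "m0 = (l, k)" "l < n" "k < l"
      using m0 by (auto simp: I_def)
    define T where "T x = (\<Sum>m\<in>I. c m *\<^sub>R S m x)" for x
    have "linear T"
      unfolding T_def by (intro linear_compose_sum ballI linear_compose_scale_right linS)
    moreover have "T x = 0" if "x \<in> range q" for x
      using that c by (auto simp: vec_eq_iff M_def T_def)
    ultimately have "T x = 0" for x
      using linear_eq_0_on_span[of T "range q" x] q by auto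
    then have "0 = T (f k) \<bullet> f l"
      by simp
    also have "\<dots> = (\<Sum>m\<in>I. c m * (S m (f k) \<bullet> f l))"
      by (simp add: T_def inner_sum_left)
    \<comment> \<open>The matrix entry at \<open>(l, k)\<close> isolates one coefficient: the
      opposite entry of another \<open>S m\<close> could contribute only for the swapped pair, which
      the ordering in \<open>I\<close> excludes.\<close>
    also have "\<dots> = (\<Sum>m\<in>I. if m = m0 then c m else 0)"
      using lk by (intro sum.cong) (auto simp: I_def S_def ff inner_diff_left split: if_splits)
    also have "\<dots> = c m0"
      using m0 by (simp add: I_def)
    finally show "c m0 = 0" ..
  qed
  ultimately have "card I \<le> dim (spherical_motions E q)"
    by (intro card_le_dim_family[where M = M]) (auto simp: I_def)
  moreover have "card I = n choose 2"
    by (simp add: I_def choose_two Sum_Ico_nat flip: atLeast0LessThan)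
  ultimately show ?thesis
    by (simp add: n_def)
qed

section \<open>Homogeneous coordinates\<close>

text \<open>Not normalised to the sphere: with last coordinate exactly 1 or 0 the motion conditions
  match those of the point-hyperplane framework, and nonzero rescaling passes to unit
  vectors.\<close>

definition homogenise ::
  "'v set \<Rightarrow> ('v \<Rightarrow> real ^ 'd) \<Rightarrow> ('v \<Rightarrow> real ^ 'd) \<Rightarrow> 'v \<Rightarrow> (real ^ 'd) \<times> real" where
  "homogenise H p a i = (if i \<in> H then (a i, 0) else (p i, 1))"

lemma dim_ph_motions:
  fixes p a :: "'v::finite \<Rightarrow> real ^ 'd"
  shows "dim (ph_motions E H p a r) = dim (spherical_motions E (homogenise H p a))"
proof -
  let ?U = "homogenise H p a"
  define f :: "((real ^ 'd) ^ 'v) \<times> ((real ^ 'd) ^ 'v) \<times> (real ^ 'v) \<Rightarrow> ((real ^ 'd) \<times> real) ^ 'v"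
    \<comment> \<open>Orthogonality to \<open>(p i, 1)\<close> dictates the last velocity coordinate
      at a point; at a hyperplane that coordinate is free and carries \<open>r'\<close>.\<close>
    where "f = (\<lambda>(p', a', r'). \<chi> i. if i \<in> H then (a' $ i, r' $ i) else (p' $ i, - (p i \<bullet> p' $ i)))"
  have f: "linear f"
    by (auto simp: f_def linear_iff vec_eq_iff algebra_simps)
  \<comment> \<open>\<open>f\<close> discards \<open>p'\<close> on \<open>H\<close> and
    \<open>a'\<close>, \<open>r'\<close> off \<open>H\<close>, so it is injective only where these
    components vanish.\<close>
  define D :: "(((real ^ 'd) ^ 'v) \<times> ((real ^ 'd) ^ 'v) \<times> (real ^ 'v)) set"
    where "D = {(p', a', r'). (\<forall>i\<in>H. p' $ i = 0) \<and> (\<forall>i\<in>- H. a' $ i = 0 \<and> r' $ i = 0)}"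
  have D: "subspace D"
    by (auto simp: D_def subspace_def zero_prod_def)
  have sub: "ph_motions E H p a r \<subseteq> D"
    by (auto simp: ph_motions_def D_def)
  have inj: "inj_on f D"
  proof (rule linear_injective_on_subspace_0[OF f D, THEN iffD2], intro ballI impI)
    fix w assume "w \<in> D" "f w = 0"
    obtain p' a' r' where w: "w = (p', a', r')"
      by (cases w)
    have "p' $ i = 0 \<and> a' $ i = 0 \<and> r' $ i = 0" for i
      using \<open>w \<in> D\<close> arg_cong[OF \<open>f w = 0\<close>, of "\<lambda>v. v $ i"]
      by (cases "i \<in> H") (auto simp: w D_def f_def zero_prod_def)
    then show "w = 0"
      by (simp add: w vec_eq_iff zero_prod_def)
  qed
  have mem: "f w \<in> spherical_motions E ?U \<longleftrightarrow> w \<in> ph_motions E H p a r" if "w \<in> D" for w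
  proof -
    obtain p' a' r' where w: "w = (p', a', r')"
      by (cases w)
    \<comment> \<open>The eliminated coordinates supply the terms that complete the product of
      differences.\<close>
    have PP: "?U i \<bullet> (f w $ j) + ?U j \<bullet> (f w $ i) = - ((p i - p j) \<bullet> (p' $ i - p' $ j))"
      if "i \<notin> H" "j \<notin> H" for i j
      using that by (simp add: w f_def homogenise_def algebra_simps)
    have PH: "?U i \<bullet> (f w $ j) + ?U j \<bullet> (f w $ i) = p i \<bullet> (a' $ j) + (p' $ i) \<bullet> a j + r' $ j"
      if "i \<notin> H" "j \<in> H" for i j
      using that by (simp add: w f_def homogenise_def inner_commute)
    have HH: "?U i \<bullet> (f w $ j) + ?U j \<bullet> (f w $ i) = a i \<bullet> (a' $ j) + (a' $ i) \<bullet> a j"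
      if "i \<in> H" "j \<in> H" for i j
      using that by (simp add: w f_def homogenise_def inner_commute)
    have diag: "?U i \<bullet> (f w $ i) = (if i \<in> H then a i \<bullet> (a' $ i) else 0)" for i
      by (simp add: w f_def homogenise_def)
    \<comment> \<open>Edge conditions are symmetric in \<open>i\<close> and \<open>j\<close>, so the
      mixed edges need only one orientation.\<close>
    have edges: "(\<forall>i j. {i, j} \<in> E \<longrightarrow> ?U i \<bullet> (f w $ j) + ?U j \<bullet> (f w $ i) = 0) \<longleftrightarrow>
      (\<forall>i\<in>- H. \<forall>j\<in>- H. {i, j} \<in> E \<longrightarrow> ?U i \<bullet> (f w $ j) + ?U j \<bullet> (f w $ i) = 0) \<and>
      (\<forall>i\<in>- H. \<forall>j\<in>H. {i, j} \<in> E \<longrightarrow> ?U i \<bullet> (f w $ j) + ?U j \<bullet> (f w $ i) = 0) \<and>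
      (\<forall>i\<in>H. \<forall>j\<in>H. {i, j} \<in> E \<longrightarrow> ?U i \<bullet> (f w $ j) + ?U j \<bullet> (f w $ i) = 0)"
      (is "(\<forall>i j. ?e i j) \<longleftrightarrow> _")
    proof -
      have "?e i j \<longleftrightarrow> ?e j i" for i j
        by (simp add: insert_commute add.commute)
      then show ?thesis
        by (meson ComplI)
    qed
    show ?thesis
      using that unfolding spherical_motions_def mem_Collect_eq edges diag
      by (simp add: PP PH HH) (auto simp: w ph_motions_def D_def)
  qed
  have "f ` ph_motions E H p a r = spherical_motions E ?U"
  proof
    show "f ` ph_motions E H p a r \<subseteq> spherical_motions E ?U"
      using sub mem by blast
    show "spherical_motions E ?U \<subseteq> f ` ph_motions E H p a r"
    proof
      fix v assume v: "v \<in> spherical_motions E ?U"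
      \<comment> \<open>The preimage under \<open>f\<close>: at points only the first component is
        kept, since the vertex condition recovers the second.\<close>
      define w where "w = ((\<chi> i. if i \<in> H then 0 else fst (v $ i)),
        (\<chi> i. if i \<in> H then fst (v $ i) else 0), (\<chi> i. if i \<in> H then snd (v $ i) else 0))"
      have "w \<in> D"
        by (simp add: w_def D_def)
      have "snd (v $ i) = - (p i \<bullet> fst (v $ i))" if "i \<notin> H" for i
      proof -
        have "?U i \<bullet> (v $ i) = 0"
          using v by (simp add: spherical_motions_def)
        with that show ?thesis
          by (simp add: homogenise_def inner_prod_def)
      qed
      then have "v = f w"
        by (auto simp: vec_eq_iff f_def w_def prod_eq_iff)
      with mem[OF \<open>w \<in> D\<close>] v show "v \<in> f ` ph_motions E H p a r"
        by blast
    qed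
  qed
  moreover have "dim (f ` ph_motions E H p a r) = dim (ph_motions E H p a r)"
    using f inj span_minimal[OF sub D] by (intro dim_image_eq) (auto intro: inj_on_subset)
  ultimately show ?thesis
    by simp
qed

text \<open>The last coordinate acts as a height: points have height 1 and normals height 0, so a
  combination has height 1 exactly when its point weights sum to 1, that is, when its point part is
  affine.\<close>

lemma ph_span_iff_span_homogenise:
  fixes p a :: "'v::finite \<Rightarrow> real ^ 'd"
  shows "{x + y | x y. x \<in> affine hull (p ` (- H)) \<and> y \<in> span (a ` H)} = UNIV \<longleftrightarrow>
    span (range (homogenise H p a)) = UNIV" (is "?A = UNIV \<longleftrightarrow> span ?R = UNIV")
proof
  assume A: "?A = UNIV"
  have pt: "(x, 1) \<in> span ?R" if "x \<in> affine hull (p ` (- H))" for x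
  proof -
    have "affine {x. (x, 1) \<in> span ?R}"
      unfolding affine_def
    proof clarsimp
      fix x y :: "real ^ 'd" and u v :: real
      assume "(x, 1) \<in> span ?R" "(y, 1) \<in> span ?R" and uv: "u + v = 1"
      then have "u *\<^sub>R (x, 1) + v *\<^sub>R (y, 1) \<in> span ?R"
        by (intro span_add span_scale)
      with uv show "(u *\<^sub>R x + v *\<^sub>R y, 1) \<in> span ?R"
        by simp
    qed
    moreover have "p ` (- H) \<subseteq> {x. (x, 1) \<in> span ?R}"
      by (auto intro!: span_base simp: homogenise_def image_iff)
    ultimately show ?thesis
      using that hull_minimal[of "p ` (- H)" _ affine] by blast
  qed
  have dir: "(y, 0) \<in> span ?R" if "y \<in> span (a ` H)" for y
    using that
  proof (induction rule: span_induct_alt)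
    case base
    show ?case
      using span_zero[of ?R] by (simp add: zero_prod_def)
  next
    case (step c x y)
    then have "(x, 0) \<in> ?R"
      by (auto simp: homogenise_def image_iff)
    then have "c *\<^sub>R (x, 0) + (y, 0) \<in> span ?R"
      using step by (intro span_add span_scale) (auto intro: span_base)
    then show ?case
      by simp
  qed
  have one: "(z, 1) \<in> span ?R" for z
  proof -
    have "z \<in> ?A"
      using A by simp
    then obtain x y where z: "z = x + y" "x \<in> affine hull (p ` (- H))" "y \<in> span (a ` H)"
      by blast
    show ?thesis
      using span_add[OF pt[OF z(2)] dir[OF z(3)]] z(1) by simp
  qed
  \<comment> \<open>Uses \<open>(z, t) = (z, 1) - (0, 1) + t *\<^sub>R (0, 1)\<close>.\<close>
  have "(z, t) \<in> span ?R" for z t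
    using span_add[OF span_diff[OF one[of z] one[of 0]] span_scale[OF one[of 0], of t]]
    by simp
  then show "span ?R = UNIV"
    by auto
next
  assume R: "span ?R = UNIV"
  let ?P = "(\<lambda>x. (x, 1::real)) ` p ` (- H)" and ?Q = "(\<lambda>x. (x, 0::real)) ` a ` H"
  have "?R = ?P \<union> ?Q"
    by (auto simp: homogenise_def image_iff)
  then have PQ: "span (?P \<union> ?Q) = UNIV"
    using R by simp
  have Q: "fst y \<in> span (a ` H) \<and> snd y = 0" if "y \<in> span ?Q" for y
    using that
    by (induction rule: span_induct_alt) (auto intro!: span_add span_scale intro: span_base span_zero)
  have "z \<in> ?A" for z
  proof -
    have "(z, 1) \<in> span (?P \<union> ?Q)"
      using PQ by simp
    then obtain x y where xy: "(z, 1) = x + y" "x \<in> span ?P" "y \<in> span ?Q"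
      unfolding span_Un by blast
    then obtain u where u: "x = (\<Sum>v\<in>?P. u v *\<^sub>R v)"
      using span_finite[of ?P] by auto
    have inj: "inj_on (\<lambda>x. (x, 1::real)) A" for A :: "(real ^ 'd) set"
      by (simp add: inj_on_def)
    \<comment> \<open>Normals contribute no height, so the point weights \<open>u (v, 1)\<close> sum
      to 1.\<close>
    have "snd x = 1"
      using xy(1) Q[OF xy(3)] by (metis add.right_neutral snd_add snd_conv)
    moreover have "snd x = (\<Sum>v\<in>p ` (- H). u (v, 1))"
      by (simp add: u snd_sum sum.reindex inj)
    moreover have "fst x = (\<Sum>v\<in>p ` (- H). u (v, 1) *\<^sub>R v)"
      by (simp add: u fst_sum sum.reindex inj)
    ultimately have "fst x \<in> affine hull (p ` (- H))"
      by (subst affine_hull_finite) (auto intro!: exI[of _ "\<lambda>v. u (v, 1)"])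
    moreover have "z = fst x + fst y"
      using xy(1) by (metis fst_add fst_conv)
    ultimately show ?thesis
      using Q[OF xy(3)] by blast
  qed
  then show "?A = UNIV"
    by auto
qed

section \<open>The equivalence\<close>

text \<open>Spanning must persist together with the upper bound on the dimension, because the lower
  bound from skew maps relies on it. The lifted vectors may leave the sphere; rescaling is done
  later.\<close>

lemma exists_rigid_lift:
  fixes q :: "'v::finite \<Rightarrow> (real ^ 'd) \<times> real"
  assumes "spherical_framework q" "spherical_inf_rigid E q"
  obtains t where "t \<noteq> 0"
    "span (range (\<lambda>i. q i + (if i \<in> Y then t else 0) *\<^sub>R (0, 1))) = UNIV"
    "dim (spherical_motions E (\<lambda>i. q i + (if i \<in> Y then t else 0) *\<^sub>R (0, 1))) =
      (CARD('d) + 1) choose 2"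
proof -
  define u where "u t i = q i + (if i \<in> Y then t else 0) *\<^sub>R (0, 1)" for t i
  have cont: "continuous_on UNIV (\<lambda>t. u t i)" for i
    unfolding u_def by (cases "i \<in> Y") (auto intro!: continuous_intros)
  have u0: "u 0 = q"
    by (simp add: u_def fun_eq_iff flip: zero_prod_def)
  have le: "\<forall>\<^sub>F t in at 0. dim (spherical_motions E (u t)) \<le> dim (spherical_motions E (u 0))"
    by (intro eventually_dim_le closed_spherical_motions cont subspace_spherical_motions)
  have "\<forall>\<^sub>F t in at 0. {x. \<forall>s\<in>range (u t). s \<bullet> x = 0} \<inter> UNIV \<subseteq> {0}"
  proof (rule eventually_Int_trivial)
    have c: "continuous_on UNIV (\<lambda>x. u (fst x) i)" for i
      by (rule continuous_on_compose2[OF cont]) (auto intro: continuous_intros)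
    have "closed {z. \<forall>i. u (fst z) i \<bullet> snd z = 0}"
      by (intro closed_Collect_all closed_Collect_eq continuous_intros c)
    then show "closed {(t, w). w \<in> {x. \<forall>s\<in>range (u t). s \<bullet> x = 0}}"
      by (simp add: case_prod_unfold)
    show "subspace {x. \<forall>s\<in>range (u t). s \<bullet> x = 0}" for t
      by (auto simp: subspace_def inner_add_right)
    show "{x. \<forall>s\<in>range (u 0). s \<bullet> x = 0} \<inter> UNIV \<subseteq> {0}"
      using assms(1) span_eq_UNIV_iff_orthogonal[of "range q"]
      by (simp add: u0 spherical_framework_def)
  qed simp
  then have "\<forall>\<^sub>F t in at 0. span (range (u t)) = UNIV"
    by (simp add: span_eq_UNIV_iff_orthogonal)
  with le have "\<forall>\<^sub>F t in at 0. t \<noteq> 0 \<and> span (range (u t)) = UNIV \<and>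
      dim (spherical_motions E (u t)) \<le> dim (spherical_motions E (u 0))"
    using eventually_neq_at_within[of 0 0 UNIV] by eventually_elim auto
  then obtain t where t: "t \<noteq> 0" "span (range (u t)) = UNIV"
      "dim (spherical_motions E (u t)) \<le> dim (spherical_motions E (u 0))"
    by (auto dest!: eventually_happens'[OF at_neq_bot])
  have dim_eq: "dim (spherical_motions E (u t)) = (CARD('d) + 1) choose 2"
    using t(3) assms(2) dim_spherical_motions_ge[OF t(2), of E]
    by (simp add: u0 spherical_inf_rigid_def)
  show thesis
    using t(1,2) dim_eq unfolding u_def[abs_def] by (rule that)
qed

theorem theorem3p2:
  fixes \<Gamma> :: "('g, 'm) monoid_scheme"
    and E :: "'v::finite set set"
    and X :: "'v set"
    and \<theta> :: "'g \<Rightarrow> 'v \<Rightarrow> 'v"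
    and \<tau> :: "'g \<Rightarrow> real ^ 'd \<Rightarrow> real ^ 'd"
  assumes "group \<Gamma>"
    and "simple_graph E"
    and "\<theta> \<in> hom \<Gamma> (graph_aut E)"
    and "\<forall>\<gamma>\<in>carrier \<Gamma>. \<theta> \<gamma> ` X = X"
    and "\<tau> \<in> hom \<Gamma> orthogonal_group"
  shows "(\<exists>q :: 'v \<Rightarrow> (real ^ 'd) \<times> real.
            spherical_framework q \<and>
            spherical_symmetric \<Gamma> \<theta> (augmented \<tau>) q \<and>
            spherical_inf_rigid E q \<and>
            (\<forall>i\<in>X. q i \<in> equator)) \<longleftrightarrow>
         (\<exists>(p :: 'v \<Rightarrow> real ^ 'd) (a :: 'v \<Rightarrow> real ^ 'd) (r :: 'v \<Rightarrow> real).
            ph_framework X p a r \<and>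
            ph_symmetric \<Gamma> \<theta> \<tau> X p a r \<and>
            ph_inf_rigid E X p a r)"
    (is "?sph \<longleftrightarrow> ?ph")
proof -
  have bij: "bij (\<theta> \<gamma>)" if "\<gamma> \<in> carrier \<Gamma>" for \<gamma>
    using assms(3) that by (auto simp: hom_def graph_aut_def Pi_iff)
  have X: "\<theta> \<gamma> i \<in> X \<longleftrightarrow> i \<in> X" if "\<gamma> \<in> carrier \<Gamma>" for \<gamma> i
    using assms(4) bij[OF that] that by (metis bij_is_inj inj_image_mem_iff)
  have orth: "orthogonal_transformation (\<tau> \<gamma>)" if "\<gamma> \<in> carrier \<Gamma>" for \<gamma>
    using assms(5) that by (auto simp: hom_def orthogonal_group_def Pi_iff)
  have scale: "\<tau> \<gamma> (c *\<^sub>R x) = c *\<^sub>R \<tau> \<gamma> x" if "\<gamma> \<in> carrier \<Gamma>" for \<gamma> c x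
    using orth[OF that] by (simp add: orthogonal_transformation_def linear_cmul)
  have norm: "norm (\<tau> \<gamma> x) = norm x" if "\<gamma> \<in> carrier \<Gamma>" for \<gamma> x
    using orth[OF that] by (simp add: orthogonal_transformation_norm)
  show ?thesis
  proof
    assume ?sph
    then obtain q :: "'v \<Rightarrow> (real ^ 'd) \<times> real" where q: "spherical_framework q"
      "spherical_symmetric \<Gamma> \<theta> (augmented \<tau>) q" "spherical_inf_rigid E q"
      "\<And>i. i \<in> X \<Longrightarrow> q i \<in> equator"
      by blast
    have sym: "fst (q (\<theta> \<gamma> i)) = \<tau> \<gamma> (fst (q i))" "snd (q (\<theta> \<gamma> i)) = snd (q i)"
      if "\<gamma> \<in> carrier \<Gamma>" for \<gamma> i
    proof -
      have "q (\<theta> \<gamma> i) = augmented \<tau> \<gamma> (q i)"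
        using q(2) that unfolding spherical_symmetric_def by simp
      then show "fst (q (\<theta> \<gamma> i)) = \<tau> \<gamma> (fst (q i))" "snd (q (\<theta> \<gamma> i)) = snd (q i)"
        by (simp_all add: augmented_def split_def)
    qed
    \<comment> \<open>The vertices that must become points but lie on the equator.\<close>
    define Y where "Y = {i. i \<notin> X \<and> snd (q i) = 0}"
    obtain t where t: "t \<noteq> 0"
        "span (range (\<lambda>i. q i + (if i \<in> Y then t else 0) *\<^sub>R (0, 1))) = UNIV"
        "dim (spherical_motions E (\<lambda>i. q i + (if i \<in> Y then t else 0) *\<^sub>R (0, 1))) =
          (CARD('d) + 1) choose 2"
      using exists_rigid_lift[OF q(1,3)] by blast
    \<comment> \<open>\<open>h\<close> is the height after lifting, \<open>p\<close> the central
      projection to height 1, and \<open>c\<close> the factor undoing it.\<close>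
    define h where "h i = snd (q i) + (if i \<in> Y then t else 0)" for i
    define p where "p i = fst (q i) /\<^sub>R h i" for i
    define a where "a i = fst (q i)" for i
    define c where "c i = (if i \<in> X then 1 else h i)" for i
    have h: "h i \<noteq> 0" if "i \<notin> X" for i
      using that t(1) by (auto simp: h_def Y_def)
    have c: "c i \<noteq> 0" for i
      using h by (simp add: c_def)
    have qX: "snd (q i) = 0" "norm (fst (q i)) = 1" if "i \<in> X" for i
      using q(4)[OF that] unfolding equator_def by (cases "q i"; simp)+
    have u: "(\<lambda>i. q i + (if i \<in> Y then t else 0) *\<^sub>R (0, 1)) = (\<lambda>i. c i *\<^sub>R homogenise X p a i)"
    proof
      fix i
      show "q i + (if i \<in> Y then t else 0) *\<^sub>R (0, 1) = c i *\<^sub>R homogenise X p a i"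
      proof (cases "i \<in> X")
        case True
        then show ?thesis
          using qX(1)[OF True] by (simp add: prod_eq_iff c_def homogenise_def a_def Y_def)
      next
        case False
        then show ?thesis
          using h[OF False] by (simp add: prod_eq_iff c_def homogenise_def p_def) (simp add: h_def)
      qed
    qed
    \<comment> \<open>Both \<open>Y\<close> and the last coordinate are invariant under the action,
      so \<open>h\<close> is constant on orbits and \<open>p\<close> is equivariant.\<close>
    have hsym: "h (\<theta> \<gamma> i) = h i" if "\<gamma> \<in> carrier \<Gamma>" for \<gamma> i
      using that by (simp add: h_def Y_def sym X)
    \<comment> \<open>All hyperplanes pass through the origin, which makes the offsets constant on
      orbits; the dimension in \<open>dim_ph_motions\<close> is the same for every offset.\<close>
    have "ph_framework X p a (\<lambda>_. 0)"
      using t(2) qX(2) unfolding u ph_framework_def ph_span_iff_span_homogenise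
      by (simp add: span_scaled_range[of c, OF c] a_def)
    moreover have "ph_symmetric \<Gamma> \<theta> \<tau> X p a (\<lambda>_. 0)"
      unfolding ph_symmetric_def
    proof (intro conjI ballI exI[of _ "\<lambda>_. 1"])
      fix \<gamma> assume \<gamma>: "\<gamma> \<in> carrier \<Gamma>"
      show "\<theta> \<gamma> ` X = X"
        using assms(4) \<gamma> by blast
      then show "\<theta> \<gamma> ` (- X) = - X"
        using bij[OF \<gamma>] by (simp add: bij_image_Compl_eq)
      show "\<tau> \<gamma> (p i) = p (\<theta> \<gamma> i)" for i
        by (simp add: p_def scale \<gamma> sym hsym)
      show "\<tau> \<gamma> (a j) = (1 * 1) *\<^sub>R a (\<theta> \<gamma> j)" for j
        by (simp add: a_def \<gamma> sym)
    qed auto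
    moreover have "ph_inf_rigid E X p a (\<lambda>_. 0)"
      using t(3) unfolding u ph_inf_rigid_def dim_ph_motions
      by (simp add: dim_spherical_motions_scaled[of c, OF c])
    ultimately show ?ph
      by blast
  next
    assume ?ph
    then obtain p a :: "'v \<Rightarrow> real ^ 'd" and r where ph: "ph_framework X p a r"
      "ph_symmetric \<Gamma> \<theta> \<tau> X p a r" "ph_inf_rigid E X p a r"
      by blast
    then obtain s :: "'v \<Rightarrow> real" where s: "\<And>j. j \<in> X \<Longrightarrow> s j \<in> {1, -1}"
      "\<And>\<gamma> j. \<gamma> \<in> carrier \<Gamma> \<Longrightarrow> j \<in> X \<Longrightarrow> \<tau> \<gamma> (a j) = (s j * s (\<theta> \<gamma> j)) *\<^sub>R a (\<theta> \<gamma> j)"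
      unfolding ph_symmetric_def by blast
    have p: "\<tau> \<gamma> (p i) = p (\<theta> \<gamma> i)" if "\<gamma> \<in> carrier \<Gamma>" "i \<notin> X" for \<gamma> i
      using ph(2) that by (simp add: ph_symmetric_def)
    have a: "norm (a j) = 1" if "j \<in> X" for j
      using ph(1) that by (simp add: ph_framework_def)
    \<comment> \<open>Replacing each normal \<open>a j\<close> by \<open>s j *\<^sub>R a j\<close>
      absorbs the signs: the square of \<open>s j\<close> is 1, so equivariance becomes exact.
      Points are normalised to the sphere.\<close>
    define c where "c i = (if i \<in> X then s i else inverse (norm (p i, 1::real)))" for i
    define q where "q i = c i *\<^sub>R homogenise X p a i" for i
    have c: "c i \<noteq> 0" for i
      using s(1)[of i] by (auto simp: c_def zero_prod_def)
    have nq: "norm (q i) = 1" for i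
    proof (cases "i \<in> X")
      case True
      then show ?thesis
        using s(1)[OF True] a[OF True] by (auto simp: q_def c_def homogenise_def norm_prod_def)
    next
      case False
      have "norm (p i, 1::real) \<noteq> 0"
        by (simp add: zero_prod_def)
      with False show ?thesis
        unfolding q_def c_def homogenise_def by (simp del: scaleR_Pair norm_eq_zero)
    qed
    have "spherical_framework q"
      using ph(1) nq unfolding spherical_framework_def ph_framework_def ph_span_iff_span_homogenise
      by (auto simp: q_def[abs_def] span_scaled_range[of c, OF c])
    moreover have "spherical_symmetric \<Gamma> \<theta> (augmented \<tau>) q"
      unfolding spherical_symmetric_def
    proof (intro ballI allI)
      fix \<gamma> i assume \<gamma>: "\<gamma> \<in> carrier \<Gamma>"
      show "augmented \<tau> \<gamma> (q i) = q (\<theta> \<gamma> i)"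
      proof (cases "i \<in> X")
        case True
        then show ?thesis
          using s(1)[OF True] by (auto simp: augmented_def q_def c_def homogenise_def X scale s(2) \<gamma>)
      next
        case False
        \<comment> \<open>Orthogonality of \<open>\<tau> \<gamma>\<close> makes the normalising
          factor constant on orbits.\<close>
        have "norm (p (\<theta> \<gamma> i)) = norm (p i)"
          using norm[OF \<gamma>, of "p i"] p[OF \<gamma> False] by simp
        with False show ?thesis
          by (simp add: augmented_def q_def c_def homogenise_def X \<gamma> scale p norm_prod_def)
      qed
    qed
    moreover have "spherical_inf_rigid E q"
      using ph(3) unfolding spherical_inf_rigid_def ph_inf_rigid_def dim_ph_motions
      by (simp add: q_def[abs_def] dim_spherical_motions_scaled[of c, OF c])
    moreover have "\<forall>i\<in>X. q i \<in> equator"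
      using nq by (simp add: equator_def) (simp add: q_def homogenise_def)
    ultimately show ?sph
      by blast
  qed
qed

end
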